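(* Let $k\in\{0,1,2\}$ and $A(t),B(t)\in M_m(C[t_0,+\infty))$. The system $\ddot{\mathbf x}+A(t)\dot{\mathbf x}+B(t)\mathbf x=0$ is $L_k$-equivalent to some system $\ddot{\xi}+V(t)\dot{\xi}+W(t)\xi=0$ with $W(t)=W^T(t)$ for all $t\ge t_0$ if and only if there exist a symmetric matrix function $S(t)=S^T(t)\in M_m(C^1[t_0,+\infty))$, a symmetric positive definite matrix $S_0\in M_m(\mathbb R)$ and a skew-symmetric matrix function $K(t)=-K^T(t)$ which satisfy the matrix differential equation $$2\dot K(t)+A(t)K(t)+K(t)A^T(t)+A(t)S(t)-S(t)A^T(t)+B(t)\Lambda(t)-\Lambda(t)B^T(t)=0,\qquad \Lambda(t)=2\int_{t_0}^{t}S(\nu)\,d\nu+S_0,$$ for $t\in[t_0,+\infty)$, together with the conditions: (1) there are constants $\mu>0$, $\eta>0$ such that for all $t\in[t_0,+\infty)$ $$\left|2\int_{t_0}^{t}\mathrm{Tr}(S(\nu))\,d\nu+\mathrm{Tr}(S_0)\right|\le\mu^2,\qquad \det\left(2\int_{t_0}^{t}S(\nu)\,d\nu+S_0\right)\ge\eta^2;$$ (2) if $k\ne0$, then for every $i\in\{0,\dots,k-1\}$ $$\sup_{t\in[t_0,+\infty)}\left\|\frac{d^i}{dt^i}K(t)\right\|+\sup_{t\in[t_0,+\infty)}\left\|\frac{d^i}{dt^i}S(t)\right\|<+\infty$$ (for $k=0$ condition (2) is omitted).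
   Context: $M_m(C^i[t_0,+\infty))$ is the space of $m\times m$ matrices whose entries are real-valued $C^i$ functions on $[t_0,+\infty)$ ($C=C^0$); $M_m(\mathbb R)$ is the space of real $m\times m$ matrices; $\|\cdot\|$ is a matrix norm. For $k\in\{0,1,2\}$, a matrix $L(t)\in M_m(C^2[t_0,+\infty))$ is an $L_k$-matrix if there is $\eta>0$ with $|\det L(t)|>\eta$ for all $t\in[t_0,+\infty)$ and $\sup_{t\ge t_0}\left\|\frac{d^i}{dt^i}L(t)\right\|<+\infty$ for all $i=0,\dots,k$. The system $\ddot{\mathbf x}+A(t)\dot{\mathbf x}+B(t)\mathbf x=0$ is $L_k$-equivalent to the system $\ddot\xi+V(t)\dot\xi+W(t)\xi=0$ (with $A,B,V,W\in M_m(C[t_0,+\infty))$) if there exists an $L_k$-matrix $L(t)$ such that for all $t\ge t_0$ $$V=L^{-1}(2\dot L+AL),\qquad W=L^{-1}(\ddot L+A\dot L+BL).$$ *)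

theory Defs
  imports "HOL-Analysis.Analysis"
begin

text \<open>
  Functions on \<open>[t\<^sub>0, \<infinity>)\<close> are total functions on the reals of which only the values on
  \<open>{t\<^sub>0..}\<close> matter: all derivatives are taken within \<open>{t\<^sub>0..}\<close>, hence are one-sided
  at \<open>t\<^sub>0\<close>.
\<close>

definition D :: "real \<Rightarrow> (real \<Rightarrow> 'a::real_normed_vector) \<Rightarrow> real \<Rightarrow> 'a" where
  "D t0 f = (\<lambda>t. vector_derivative f (at t within {t0..}))"

definition C_on :: "nat \<Rightarrow> real \<Rightarrow> (real \<Rightarrow> real) \<Rightarrow> bool" where
  "C_on i t0 f \<longleftrightarrow>
     (\<forall>j<i. ((D t0 ^^ j) f) differentiable_on {t0..}) \<and> continuous_on {t0..} ((D t0 ^^ i) f)"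

definition mat_C :: "nat \<Rightarrow> real \<Rightarrow> (real \<Rightarrow> real ^ 'm ^ 'm) set" where
  "mat_C i t0 = {M. \<forall>p q. C_on i t0 (\<lambda>t. M t $ p $ q)}"

definition symmetric_matrix :: "real ^ 'm ^ 'm \<Rightarrow> bool" where
  "symmetric_matrix M \<longleftrightarrow> M = transpose M"

definition skew_symmetric_matrix :: "real ^ 'm ^ 'm \<Rightarrow> bool" where
  "skew_symmetric_matrix M \<longleftrightarrow> M = - transpose M"

definition positive_definite :: "real ^ 'm ^ 'm \<Rightarrow> bool" where
  "positive_definite M \<longleftrightarrow> (\<forall>x. x \<noteq> 0 \<longrightarrow> x \<bullet> (M *v x) > 0)"

text \<open>
  The norm on \<open>real ^ 'm ^ 'm\<close> is the Frobenius norm; boundedness does not depend on the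
  choice of the matrix norm. A supremum of norms is finite iff the set of norms is bounded above.
\<close>

definition L_matrix :: "nat \<Rightarrow> real \<Rightarrow> (real \<Rightarrow> real ^ 'm ^ 'm) \<Rightarrow> bool" where
  "L_matrix k t0 L \<longleftrightarrow>
     L \<in> mat_C 2 t0 \<and>
     (\<exists>\<eta>>0. \<forall>t\<ge>t0. \<bar>det (L t)\<bar> > \<eta>) \<and>
     (\<forall>i\<in>{0..k}. bdd_above ((\<lambda>t. norm ((D t0 ^^ i) L t)) ` {t0..}))"

text \<open>
  A system \<open>x'' + A(t) x' + B(t) x = 0\<close> is represented by its coefficients \<open>A\<close>, \<open>B\<close>.
\<close>

definition L_equivalent ::
  "nat \<Rightarrow> real \<Rightarrow> (real \<Rightarrow> real ^ 'm ^ 'm) \<Rightarrow> (real \<Rightarrow> real ^ 'm ^ 'm)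
    \<Rightarrow> (real \<Rightarrow> real ^ 'm ^ 'm) \<Rightarrow> (real \<Rightarrow> real ^ 'm ^ 'm) \<Rightarrow> bool" where
  "L_equivalent k t0 A B V W \<longleftrightarrow>
     A \<in> mat_C 0 t0 \<and> B \<in> mat_C 0 t0 \<and> V \<in> mat_C 0 t0 \<and> W \<in> mat_C 0 t0 \<and>
     (\<exists>L. L_matrix k t0 L \<and>
        (\<forall>t\<ge>t0.
           V t = matrix_inv (L t) ** (2 *\<^sub>R D t0 L t + A t ** L t) \<and>
           W t = matrix_inv (L t) ** ((D t0 ^^ 2) L t + A t ** D t0 L t + B t ** L t)))"

definition Lambda :: "real \<Rightarrow> (real \<Rightarrow> real ^ 'm ^ 'm) \<Rightarrow> real ^ 'm ^ 'm \<Rightarrow> real \<Rightarrow> real ^ 'm ^ 'm" where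
  "Lambda t0 S S0 t = 2 *\<^sub>R integral {t0..t} S + S0"

end

theory Submission imports Defs begin

text \<open>
  The proof idea is to encode a transformation matrix \<open>L\<close> by the pair \<open>P = L L\<^sup>T\<close>, \<open>N = L' L\<^sup>T = S + K\<close>
  with \<open>S\<close> symmetric and \<open>K\<close> skew-symmetric. Then \<open>P' = N + N\<^sup>T = 2 S\<close>, so \<open>P\<close> is the function
  \<open>\<Lambda>\<close>, and since \<open>L'' L\<^sup>T = N' - L' L'\<^sup>T\<close>, the matrix
  \<open>L W L\<^sup>T = N' - L' L'\<^sup>T + A N + B P\<close> is symmetric iff the differential equation for \<open>K\<close> holds.

  Conversely, \<open>L\<close> is recovered from \<open>S\<close>, \<open>K\<close>, \<open>S\<^sub>0\<close> as the solution of the linear equation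
  \<open>L' = N \<Lambda>\<^sup>-\<^sup>1 L\<close> with \<open>L(t\<^sub>0) L(t\<^sub>0)\<^sup>T = S\<^sub>0\<close>: both \<open>L L\<^sup>T\<close> and \<open>\<Lambda>\<close> solve
  \<open>X' = M X + X M\<^sup>T\<close> with \<open>M = N \<Lambda>\<^sup>-\<^sup>1\<close>, hence they agree.
  As \<open>Tr (L L\<^sup>T)\<close> is the squared Frobenius norm of \<open>L\<close>, the bounds on \<open>Tr \<Lambda>\<close> and \<open>det \<Lambda>\<close> say that
  \<open>L\<close> and \<open>L\<^sup>-\<^sup>1\<close> are bounded, so that \<open>L'\<close> and \<open>L''\<close> are bounded iff \<open>N\<close> and \<open>N'\<close> are.
\<close>

subsection \<open>Linear differential equations on a half-line\<close>

text \<open>Transfers calculus on compact intervals to the half-line: with \<open>t < T\<close> the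
  right end \<open>T\<close> is invisible near \<open>t\<close>.\<close>

lemma at_within_atLeastAtMost_eq:
  fixes t :: real
  assumes "t < T"
  shows "at t within {a..T} = at t within {a..}"
  by (rule at_within_nhd[of _ "{..<T}"]) (use assms in auto)

lemma indefinite_integral_has_vector_derivative:
  fixes f :: "real \<Rightarrow> 'a::banach"
  assumes "continuous_on {a..} f" "a \<le> t"
  shows "((\<lambda>t. integral {a..t} f) has_vector_derivative f t) (at t within {a..})"
proof -
  have "continuous_on {a..t + 1} f"
    using assms(1) by (rule continuous_on_subset) auto
  from integral_has_vector_derivative[OF this, of t] assms(2) show ?thesis
    by (simp add: at_within_atLeastAtMost_eq)
qed

text \<open>Picard iteration written as a series. On \<open>{a..T}\<close> the \<open>n\<close>-th
  term is at most \<open>norm init * (C * (t - a)) ^ n / fact n\<close>, so the series converges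
  uniformly there and can be differentiated termwise. The product is abstract so that coefficients
  acting from the left and from the right are both covered.\<close>

lemma linear_ode_solution_exists:
  fixes M :: "real \<Rightarrow> 'a::real_normed_vector" and init :: "'b::banach"
    and prod :: "'a \<Rightarrow> 'b \<Rightarrow> 'b"
  assumes prod: "bounded_bilinear prod" and M: "continuous_on {a..} M"
  obtains u where "u a = init"
    and "\<And>t. a \<le> t \<Longrightarrow> (u has_vector_derivative prod (M t) (u t)) (at t within {a..})"
proof -
  interpret bounded_bilinear prod by (fact prod)
  obtain K where K: "0 < K" "\<And>x y. norm (prod x y) \<le> norm x * norm y * K"
    using pos_bounded by blast
  \<comment> \<open>These are the increments of the Picard iteration, not the iterates:
    \<open>init\<close> enters in term 0 only, and the derivative of each later term is
    \<open>prod (M t)\<close> applied to its predecessor.\<close>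
  define u where "u = rec_nat (\<lambda>t. init) (\<lambda>_ v t. integral {a..t} (\<lambda>s. prod (M s) (v s)))"
  have u_0: "u 0 t = init" for t
    by (simp add: u_def)
  have u_Suc: "u (Suc n) t = integral {a..t} (\<lambda>s. prod (M s) (u n s))" for n t
    by (simp add: u_def)
  have cont: "continuous_on {a..} (u n)" for n
  proof (induction n)
    case 0
    then show ?case by (simp add: u_0)
  next
    case (Suc n)
    have "((u (Suc n)) has_vector_derivative prod (M t) (u n t)) (at t within {a..})" if "a \<le> t" for t
      unfolding u_Suc
      by (rule indefinite_integral_has_vector_derivative) (use that M Suc in \<open>auto intro!: continuous_on\<close>)
    then show ?case
      by (intro continuous_on_vector_derivative) auto
  qed
  have der: "((u (Suc n)) has_vector_derivative prod (M t) (u n t)) (at t within {a..})"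
    if "a \<le> t" for n t
    unfolding u_Suc
    by (rule indefinite_integral_has_vector_derivative) (use that M cont in \<open>auto intro!: continuous_on\<close>)
  \<comment> \<open>\<open>C\<close> may depend on \<open>T\<close>, since \<open>M\<close> is
    bounded on compact intervals only; it also absorbs the constant \<open>K\<close> of the bilinear
    product.\<close>
  have bound: "\<exists>C\<ge>0. (\<forall>t\<in>{a..T}. norm (M t) * K \<le> C) \<and>
      (\<forall>n. \<forall>t\<in>{a..T}. norm (u n t) \<le> norm init * (C * (t - a)) ^ n / fact n)" for T
  proof -
    have "bounded (M ` {a..T})"
      by (intro compact_imp_bounded compact_continuous_image continuous_on_subset[OF M]) auto
    then obtain c where c: "c > 0" "\<And>t. t \<in> {a..T} \<Longrightarrow> norm (M t) \<le> c"
      by (auto simp: bounded_pos)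
    define C where "C = c * K"
    have C: "C \<ge> 0" "\<And>t. t \<in> {a..T} \<Longrightarrow> norm (M t) * K \<le> C"
      using c K(1) by (auto simp: C_def)
    have "norm (u n t) \<le> norm init * (C * (t - a)) ^ n / fact n" if "t \<in> {a..T}" for n t
      using that
    proof (induction n arbitrary: t)
      case 0
      then show ?case by (simp add: u_0)
    next
      case (Suc n)
      \<comment> \<open>\<open>?g'\<close> is \<open>C\<close> times the bound for term
        \<open>n\<close>, and \<open>?g\<close> is its antiderivative vanishing at \<open>a\<close>;
        integrating gives exactly the bound for term \<open>Suc n\<close>.\<close>
      let ?g = "\<lambda>s. norm init * (C * (s - a)) ^ Suc n / fact (Suc n)"
      let ?g' = "\<lambda>s. C * (norm init * (C * (s - a)) ^ n / fact n)"
      have sub: "{a..t} \<subseteq> {a..}" by auto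
      have "(?g' has_integral ?g t - ?g a) {a..t}"
      proof (rule fundamental_theorem_of_calculus)
        fix s assume "s \<in> {a..t}"
        have "((\<lambda>s. (C * (s - a)) ^ Suc n) has_real_derivative real (Suc n) * (C * (s - a)) ^ n * C)
            (at s within {a..t})"
          by (rule derivative_eq_intros refl | simp)+
        then have "((\<lambda>s. norm init / fact (Suc n) * (C * (s - a)) ^ Suc n) has_real_derivative
            norm init / fact (Suc n) * (real (Suc n) * (C * (s - a)) ^ n * C)) (at s within {a..t})"
          by (rule DERIV_cmult)
        moreover have "norm init / fact (Suc n) * (real (Suc n) * (C * (s - a)) ^ n * C) = ?g' s"
          by (simp add: divide_simps del: of_nat_Suc)
        ultimately have "(?g has_real_derivative ?g' s) (at s within {a..t})"
          by (simp only: times_divide_eq_left)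
        then show "(?g has_vector_derivative ?g' s) (at s within {a..t})"
          by (simp add: has_real_derivative_iff_has_vector_derivative)
      qed (use Suc.prems in auto)
      then have g: "(?g' has_integral ?g t) {a..t}" by simp
      have "norm (u (Suc n) t) \<le> integral {a..t} ?g'"
        unfolding u_Suc
      proof (rule integral_norm_bound_integral)
        show "(\<lambda>s. prod (M s) (u n s)) integrable_on {a..t}"
          by (intro integrable_continuous_real continuous_on
                continuous_on_subset[OF M sub] continuous_on_subset[OF cont sub])
        show "?g' integrable_on {a..t}" using g by blast
        fix s assume s: "s \<in> {a..t}"
        with Suc.prems have s': "s \<in> {a..T}" by auto
        have "norm (prod (M s) (u n s)) \<le> (norm (M s) * K) * norm (u n s)"
          using K(2)[of "M s" "u n s"] by (simp add: mult_ac)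
        also have "\<dots> \<le> ?g' s"
          using C(1) C(2)[OF s'] Suc.IH[OF s'] by (intro mult_mono) auto
        finally show "norm (prod (M s) (u n s)) \<le> ?g' s" .
      qed
      then show ?case
        by (simp only: integral_unique[OF g])
    qed
    with C show ?thesis by blast
  qed
  define x where "x t = (\<Sum>n. u n t)" for t
  have "x a = init"
  proof -
    have "u n a = 0" if "n \<noteq> 0" for n
      using that by (cases n) (auto simp: u_Suc)
    then have "x a = (\<Sum>n\<in>{0}. u n a)"
      unfolding x_def by (intro suminf_finite) auto
    then show ?thesis by (simp add: u_0)
  qed
  moreover have "(x has_vector_derivative prod (M t) (x t)) (at t within {a..})" if t: "a \<le> t" for t
  proof -
    \<comment> \<open>Any \<open>T\<close> beyond \<open>t\<close> would do: the series is
      differentiated on \<open>{a..T}\<close>, and at \<open>t\<close> this is the derivative within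
      \<open>{a..}\<close>.\<close>
    define T where "T = t + 1"
    obtain C where C: "C \<ge> 0" "\<And>s. s \<in> {a..T} \<Longrightarrow> norm (M s) * K \<le> C"
      "\<And>n s. s \<in> {a..T} \<Longrightarrow> norm (u n s) \<le> norm init * (C * (s - a)) ^ n / fact n"
      using bound[of T] by blast
    define b where "b n = norm init * (C * (T - a)) ^ n / fact n" for n
    have ub: "norm (u n s) \<le> b n" if "s \<in> {a..T}" for n s
    proof -
      have "norm init * (C * (s - a)) ^ n / fact n \<le> b n"
        unfolding b_def using that C(1)
        by (intro divide_right_mono mult_left_mono power_mono) auto
      with C(3)[OF that] show ?thesis by (rule order_trans)
    qed
    have "summable b"
      unfolding b_def using summable_mult[OF summable_exp[of "C * (T - a)"], of "norm init"]
      by (simp add: field_simps)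
    then have unif: "uniform_limit {a..T} (\<lambda>n s. \<Sum>i<n. u i s) x sequentially"
      unfolding x_def using ub by (intro Weierstrass_m_test) auto
    define u' where "u' n s = (case n of 0 \<Rightarrow> 0 | Suc m \<Rightarrow> prod (M s) (u m s))" for n s
    have u': "(u n has_vector_derivative u' n s) (at s within {a..T})" if "s \<in> {a..T}" for n s
    proof (cases n)
      case 0
      have "u 0 = (\<lambda>_. init)" by (auto simp: u_0)
      with 0 show ?thesis by (simp add: u'_def)
    next
      case (Suc m)
      then show ?thesis
        using that der[of s m] by (auto simp: u'_def intro: has_vector_derivative_within_subset)
    qed
    \<comment> \<open>The constant term 0 has derivative 0, so the derivatives lag one index behind
      the terms.\<close>
    have sum_u': "(\<Sum>i<Suc n. u' i s) = prod (M s) (\<Sum>i<n. u i s)" for n s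
      by (subst sum.lessThan_Suc_shift) (simp add: u'_def sum_right)
    have "\<exists>g. \<forall>s\<in>{a..T}. (\<lambda>n. u n s) sums g s \<and>
        (g has_derivative (\<lambda>h. h *\<^sub>R prod (M s) (x s))) (at s within {a..T})"
    proof (rule has_derivative_series)
      show "convex {a..T}" by simp
      show "(u n has_derivative (\<lambda>h. h *\<^sub>R u' n s)) (at s within {a..T})" if "s \<in> {a..T}" for n s
        using u'[OF that] by (simp add: has_vector_derivative_def)
      show "a \<in> {a..T}" using t by (simp add: T_def)
      then show "(\<lambda>n. u n a) sums x a"
        unfolding x_def by (intro summable_sums summable_comparison_test'[OF \<open>summable b\<close>] ub)
      fix e :: real assume "e > 0"
      \<comment> \<open>Chosen so that \<open>C * d \<le> e\<close>; the added 1 keeps the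
        denominator positive when \<open>C = 0\<close>.\<close>
      define d where "d = e / (C + 1)"
      have d: "d > 0" "C * d \<le> e"
        using \<open>e > 0\<close> C(1) by (auto simp: d_def field_simps)
      have "\<forall>\<^sub>F n in sequentially. \<forall>s\<in>{a..T}. dist (\<Sum>i<n. u i s) (x s) < d"
        using unif d(1) by (auto simp: uniform_limit_iff)
      then have "\<forall>\<^sub>F n in sequentially. \<forall>s\<in>{a..T}. \<forall>h.
          norm ((\<Sum>i<Suc n. h *\<^sub>R u' i s) - h *\<^sub>R prod (M s) (x s)) \<le> e * norm h"
      proof (eventually_elim, intro ballI allI)
        fix n s h
        assume "\<forall>s\<in>{a..T}. dist (\<Sum>i<n. u i s) (x s) < d" and s: "s \<in> {a..T}"
        then have less: "norm ((\<Sum>i<n. u i s) - x s) \<le> d"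
          by (auto simp: dist_norm intro: less_imp_le)
        have "(\<Sum>i<Suc n. h *\<^sub>R u' i s) - h *\<^sub>R prod (M s) (x s)
            = h *\<^sub>R prod (M s) ((\<Sum>i<n. u i s) - x s)"
          by (simp only: scaleR_sum_right[symmetric] sum_u' scaleR_diff_right diff_right)
        moreover have "norm (prod (M s) ((\<Sum>i<n. u i s) - x s)) \<le> e"
        proof -
          have "norm (prod (M s) ((\<Sum>i<n. u i s) - x s)) \<le> (norm (M s) * K) * norm ((\<Sum>i<n. u i s) - x s)"
            using K(2)[of "M s" "(\<Sum>i<n. u i s) - x s"] by (simp add: mult_ac)
          also have "\<dots> \<le> C * d"
            using C(1) C(2)[OF s] less by (intro mult_mono) auto
          finally show ?thesis using d(2) by linarith
        qed
        ultimately show "norm ((\<Sum>i<Suc n. h *\<^sub>R u' i s) - h *\<^sub>R prod (M s) (x s)) \<le> e * norm h"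
          by (simp del: sum.lessThan_Suc add: mult.commute[of e] mult_left_mono)
      qed
      then show "\<forall>\<^sub>F n in sequentially. \<forall>s\<in>{a..T}. \<forall>h.
          norm ((\<Sum>i<n. h *\<^sub>R u' i s) - h *\<^sub>R prod (M s) (x s)) \<le> e * norm h"
        by (subst (asm) eventually_sequentially_Suc)
    qed
    then obtain g where g: "\<And>s. s \<in> {a..T} \<Longrightarrow> (\<lambda>n. u n s) sums g s"
      "\<And>s. s \<in> {a..T} \<Longrightarrow> (g has_vector_derivative prod (M s) (x s)) (at s within {a..T})"
      unfolding has_vector_derivative_def by blast
    have "x s = g s" if "s \<in> {a..T}" for s
      using g(1)[OF that] by (simp add: x_def sums_iff)
    then have "(x has_vector_derivative prod (M t) (x t)) (at t within {a..T})"
      by (intro has_vector_derivative_transform[OF _ _ g(2)]) (use t in \<open>auto simp: T_def\<close>)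
    then show ?thesis
      by (simp add: at_within_atLeastAtMost_eq T_def)
  qed
  ultimately show ?thesis by (rule that)
qed

subsection \<open>Matrix calculus\<close>

lemma matrix_add_rdistrib: "((A + B) ** C :: 'a::semiring_1 ^ 'n ^ 'm) = A ** C + B ** C"
  by (vector matrix_matrix_mult_def sum.distrib[symmetric] distrib_right)

text \<open>Gives the product rule, limits and continuity for \<open>**\<close> through the
  interpretation below, and makes \<open>**\<close> and its flip admissible products in the linear
  differential equation.\<close>

lemma bounded_bilinear_matrix_mult:
  "bounded_bilinear ((**) :: real ^ 'n ^ 'm \<Rightarrow> real ^ 'p ^ 'n \<Rightarrow> real ^ 'p ^ 'm)"
  unfolding bilinear_conv_bounded_bilinear[symmetric] bilinear_def
  by (auto intro!: linearI simp: matrix_add_ldistrib matrix_add_rdistrib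
      matrix_scalar_ac scalar_matrix_assoc)

interpretation matrix_mult: bounded_bilinear "(**) :: real ^ 'n ^ 'm \<Rightarrow> real ^ 'p ^ 'n \<Rightarrow> real ^ 'p ^ 'm"
  by (rule bounded_bilinear_matrix_mult)

lemma bounded_linear_transpose: "bounded_linear (transpose :: real ^ 'n ^ 'm \<Rightarrow> real ^ 'm ^ 'n)"
  unfolding linear_conv_bounded_linear[symmetric]
  by (rule linearI) (simp_all add: transpose_def vec_eq_iff)

lemmas linear_transpose = bounded_linear.linear[OF bounded_linear_transpose]
lemmas transpose_linear_simps = linear_add[OF linear_transpose] linear_diff[OF linear_transpose]
  linear_neg[OF linear_transpose] linear_scale[OF linear_transpose]

lemma bounded_linear_trace: "bounded_linear (trace :: real ^ 'n ^ 'n \<Rightarrow> real)"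
  unfolding linear_conv_bounded_linear[symmetric]
  by (rule linearI) (simp_all add: trace_def sum.distrib sum_distrib_left)

lemma trace_mult_transpose: "trace (L ** transpose L) = (norm L)\<^sup>2" for L :: "real ^ 'n ^ 'm"
  by (simp add: trace_def matrix_matrix_mult_def transpose_def power2_norm_eq_inner inner_vec_def)

lemma matrix_inv:
  fixes M :: "real ^ 'n ^ 'n"
  assumes "invertible M"
  shows matrix_inv_right: "M ** matrix_inv M = mat 1"
    and matrix_inv_left: "matrix_inv M ** M = mat 1"
proof -
  have "M ** matrix_inv M = mat 1 \<and> matrix_inv M ** M = mat 1"
    using assms unfolding invertible_def matrix_inv_def by (rule someI_ex)
  then show "M ** matrix_inv M = mat 1" "matrix_inv M ** M = mat 1" by auto
qed

lemma matrix_inv_cancel: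
  fixes M :: "real ^ 'n ^ 'n"
  assumes "invertible M"
  shows "M ** (matrix_inv M ** X) = X" "matrix_inv M ** (M ** X) = X"
    and "X ** M ** matrix_inv M = X" "X ** matrix_inv M ** M = X"
  using matrix_inv[OF assms] by (simp_all add: matrix_mul_assoc) (simp_all flip: matrix_mul_assoc)

text \<open>The columns of the inverse solve \<open>M *v x = axis l 1\<close>, so Cramer's rule
  applies. The formula reduces continuity of the inverse to that of determinants.\<close>

lemma matrix_inv_cramer:
  fixes M :: "real ^ 'n ^ 'n"
  assumes "invertible M"
  shows "matrix_inv M =
    (\<chi> k l. det (\<chi> i j. if j = k then axis l 1 $ i else M $ i $ j) / det M)"
proof -
  have "M *v (\<chi> k. matrix_inv M $ k $ l) = axis l 1" for l
  proof -
    have "(M ** matrix_inv M) $ i $ l = axis l 1 $ i" for i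
      by (simp add: matrix_inv_right[OF assms] mat_def axis_def)
    then show ?thesis
      by (simp add: vec_eq_iff matrix_vector_mult_def matrix_matrix_mult_def)
  qed
  then have "(\<chi> k. matrix_inv M $ k $ l) =
      (\<chi> k. det (\<chi> i j. if j = k then axis l 1 $ i else M $ i $ j) / det M)" for l
    using cramer[of M] assms by (auto simp: invertible_det_nz)
  then show ?thesis
    by (simp add: vec_eq_iff)
qed

section \<open>Determinant and inverse: continuity, bounds, derivative\<close>

lemma continuous_on_det:
  fixes M :: "'a::topological_space \<Rightarrow> real ^ 'n ^ 'n"
  assumes "continuous_on X M"
  shows "continuous_on X (\<lambda>t. det (M t))"
  unfolding det_def by (intro continuous_intros assms)

lemma continuous_on_if_const:
  "(P \<Longrightarrow> continuous_on X f) \<Longrightarrow> (\<not> P \<Longrightarrow> continuous_on X g) \<Longrightarrow>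
    continuous_on X (\<lambda>t. if P then f t else g t)"
  by (cases P) auto

lemma continuous_on_matrix_inv:
  fixes M :: "'a::topological_space \<Rightarrow> real ^ 'n ^ 'n"
  assumes "continuous_on X M" and "\<And>t. t \<in> X \<Longrightarrow> invertible (M t)"
  shows "continuous_on X (\<lambda>t. matrix_inv (M t))"
proof -
  have "continuous_on X (\<lambda>t. \<chi> k l. det (\<chi> i j. if j = k then axis l 1 $ i else M t $ i $ j) / det (M t))"
    using assms
    by (intro continuous_on_vec_lambda continuous_on_divide continuous_on_det continuous_on_if_const
        continuous_on_component continuous_on_const) (auto simp: invertible_det_nz)
  then show ?thesis
    using assms(2) by (subst continuous_on_cong[OF refl matrix_inv_cramer]) auto
qed

text \<open>The matrices in a closed ball whose determinant has absolute value at least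
  \<open>e\<close> form a compact set, and inversion is continuous on it.\<close>

lemma bounded_matrix_inv:
  fixes M :: "'a \<Rightarrow> real ^ 'n ^ 'n"
  assumes "bounded (M ` X)" and "e > 0" and "\<And>t. t \<in> X \<Longrightarrow> e \<le> \<bar>det (M t)\<bar>"
  shows "bounded ((\<lambda>t. matrix_inv (M t)) ` X)"
proof -
  obtain c where c: "\<And>t. t \<in> X \<Longrightarrow> M t \<in> cball 0 c"
    using assms(1) by (auto simp: bounded_iff)
  define Y where "Y = cball (0 :: real ^ 'n ^ 'n) c \<inter> {A. e \<le> \<bar>det A\<bar>}"
  have "closed {A :: real ^ 'n ^ 'n. e \<le> \<bar>det A\<bar>}"
    by (intro closed_Collect_le continuous_intros continuous_on_det)
  then have "compact Y"
    unfolding Y_def by (intro compact_Int_closed compact_cball)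
  moreover have "continuous_on Y matrix_inv"
    using \<open>e > 0\<close>
    by (intro continuous_on_matrix_inv[of Y "\<lambda>A. A"]) (auto simp: Y_def invertible_det_nz)
  ultimately have "bounded (matrix_inv ` Y)"
    by (intro compact_imp_bounded compact_continuous_image)
  then show ?thesis
    by (rule bounded_subset) (use c assms(3) in \<open>auto simp: Y_def\<close>)
qed

lemma bounded_matrix_mult:
  fixes f :: "'a \<Rightarrow> real ^ 'n ^ 'm" and g :: "'a \<Rightarrow> real ^ 'p ^ 'n"
  assumes "bounded (f ` X)" "bounded (g ` X)"
  shows "bounded ((\<lambda>t. f t ** g t) ` X)"
proof -
  obtain a b where ab: "a > 0" "\<And>t. t \<in> X \<Longrightarrow> norm (f t) \<le> a" "b > 0" "\<And>t. t \<in> X \<Longrightarrow> norm (g t) \<le> b"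
    using assms by (auto simp: bounded_pos)
  moreover obtain K where K: "K \<ge> 0" "\<And>A :: real ^ 'n ^ 'm. \<And>B :: real ^ 'p ^ 'n. norm (A ** B) \<le> norm A * norm B * K"
    using matrix_mult.nonneg_bounded by blast
  ultimately have "norm (f t ** g t) \<le> a * b * K" if "t \<in> X" for t
    using that by (intro order_trans[OF K(2)] mult_mono) auto
  then show ?thesis
    by (auto simp: bounded_iff)
qed

lemma has_vector_derivative_iff_tendsto:
  fixes f :: "real \<Rightarrow> 'a::real_normed_vector"
  shows "(f has_vector_derivative f') (at t within X) \<longleftrightarrow>
    ((\<lambda>s. (f s - f t) /\<^sub>R (s - t)) \<longlongrightarrow> f') (at t within X)"
proof -
  let ?q = "\<lambda>s. (f s - f t) /\<^sub>R (s - t)"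
  have "norm ((f s - f t - (s - t) *\<^sub>R f') /\<^sub>R norm (s - t)) = norm (?q s - f')" if "s \<noteq> t" for s
  proof -
    have "?q s - f' = (f s - f t - (s - t) *\<^sub>R f') /\<^sub>R (s - t)"
      using that by (simp add: scaleR_diff_right)
    then show ?thesis by simp
  qed
  then have eq: "\<forall>\<^sub>F s in at t within X.
      norm ((f s - f t - (s - t) *\<^sub>R f') /\<^sub>R norm (s - t)) = norm (?q s - f')"
    by (auto simp: eventually_at_filter)
  have "(f has_vector_derivative f') (at t within X) \<longleftrightarrow>
      ((\<lambda>s. norm ((f s - f t - (s - t) *\<^sub>R f') /\<^sub>R norm (s - t))) \<longlongrightarrow> 0) (at t within X)"
    unfolding has_vector_derivative_def has_derivative_iff_norm
    by (simp add: bounded_linear_scaleR_left divide_inverse mult.commute)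
  also have "\<dots> \<longleftrightarrow> ((\<lambda>s. norm (?q s - f')) \<longlongrightarrow> 0) (at t within X)"
    by (rule tendsto_cong[OF eq])
  also have "\<dots> \<longleftrightarrow> (?q \<longlongrightarrow> f') (at t within X)"
    by (simp add: tendsto_norm_zero_iff LIM_zero_iff)
  finally show ?thesis .
qed

text \<open>Divide the identity \<open>?I s - ?I t = - ?I s ** (M s - M t) ** ?I t\<close>, where
  \<open>?I\<close> is the inverse, by \<open>s - t\<close> and let \<open>s\<close> tend to
  \<open>t\<close>, using continuity of the inverse.\<close>

lemma matrix_inv_has_vector_derivative:
  fixes M :: "real \<Rightarrow> real ^ 'n ^ 'n"
  assumes M: "(M has_vector_derivative M') (at t within X)" and t: "t \<in> X"
    and inv: "\<And>s. s \<in> X \<Longrightarrow> invertible (M s)"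
    and cont: "continuous_on X M"
  shows "((\<lambda>s. matrix_inv (M s)) has_vector_derivative
    - (matrix_inv (M t) ** M' ** matrix_inv (M t))) (at t within X)"
proof -
  let ?I = "\<lambda>s. matrix_inv (M s)"
  have I: "(?I \<longlongrightarrow> ?I t) (at t within X)"
    using continuous_on_matrix_inv[OF cont inv] t by (auto simp: continuous_on)
  have "((\<lambda>s. (M s - M t) /\<^sub>R (s - t)) \<longlongrightarrow> M') (at t within X)"
    using M by (simp add: has_vector_derivative_iff_tendsto)
  then have "((\<lambda>s. - (?I s ** ((M s - M t) /\<^sub>R (s - t)) ** ?I t))
      \<longlongrightarrow> - (?I t ** M' ** ?I t)) (at t within X)"
    by (intro tendsto_minus matrix_mult.tendsto I tendsto_const)
  moreover have "\<forall>\<^sub>F s in at t within X.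
      - (?I s ** ((M s - M t) /\<^sub>R (s - t)) ** ?I t) = (?I s - ?I t) /\<^sub>R (s - t)"
  proof -
    have "- (?I s ** ((M s - M t) /\<^sub>R (s - t)) ** ?I t) = (?I s - ?I t) /\<^sub>R (s - t)"
      if "s \<in> X" for s
      using matrix_inv_cancel[OF inv[OF that]] matrix_inv_cancel[OF inv[OF t]] matrix_inv[OF inv[OF that]]
      by (simp add: matrix_mult.diff_left matrix_mult.diff_right matrix_mult.scaleR_left
          matrix_mult.scaleR_right scaleR_diff_right)
    then show ?thesis by (simp add: eventually_at_filter)
  qed
  ultimately show ?thesis
    unfolding has_vector_derivative_iff_tendsto by (rule Lim_transform_eventually)
qed

subsection \<open>Factorizations along a differentiable path\<close>

lemma constant_if_derivative_zero:
  fixes f :: "real \<Rightarrow> 'a::real_normed_vector"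
  assumes "\<And>t. a \<le> t \<Longrightarrow> (f has_vector_derivative 0) (at t within {a..})" "a \<le> t"
  shows "f t = f a"
proof -
  obtain c where "\<And>t. t \<in> {a..} \<Longrightarrow> f t = c"
    using has_vector_derivative_zero_constant[of "{a..}" f] assms(1) by auto
  then show ?thesis using assms(2) by simp
qed

lemmas has_vector_derivative_transpose =
  bounded_linear.has_vector_derivative[OF bounded_linear_transpose]

text \<open>Let \<open>X\<close> be the fundamental solution of \<open>X' = M X\<close> with
  \<open>M = N P^-1\<close>, and \<open>Y\<close> its inverse. Since
  \<open>P' = M P + P M^T\<close>, the product \<open>Y P Y^T\<close> is constant, so
  \<open>P = X P(a) X^T\<close> and \<open>L = X L0\<close> is the required factor.\<close>

lemma gram_factorization:
  fixes P N :: "real \<Rightarrow> real ^ 'n ^ 'n" and L0 :: "real ^ 'n ^ 'n"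
  assumes P: "\<And>t. a \<le> t \<Longrightarrow> (P has_vector_derivative N t + transpose (N t)) (at t within {a..})"
    and N: "continuous_on {a..} N"
    and inv: "\<And>t. a \<le> t \<Longrightarrow> invertible (P t)"
    and sym: "\<And>t. a \<le> t \<Longrightarrow> transpose (P t) = P t"
    and L0: "L0 ** transpose L0 = P a"
  obtains L :: "real \<Rightarrow> real ^ 'n ^ 'n" where "\<And>t. a \<le> t \<Longrightarrow> L t ** transpose (L t) = P t"
    and "\<And>t. a \<le> t \<Longrightarrow> (L has_vector_derivative N t ** matrix_inv (P t) ** L t) (at t within {a..})"
proof -
  define M where "M t = N t ** matrix_inv (P t)" for t
  have MP: "M t ** P t = N t" and PM: "P t ** transpose (M t) = transpose (N t)" if "a \<le> t" for t
  proof -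
    show "M t ** P t = N t"
      using matrix_inv_cancel[OF inv[OF that]] by (simp add: M_def)
    then show "P t ** transpose (M t) = transpose (N t)"
      by (metis matrix_transpose_mul sym that)
  qed
  have "continuous_on {a..} P"
    using P by (intro continuous_on_vector_derivative) auto
  then have M: "continuous_on {a..} M"
    unfolding M_def using N inv by (intro matrix_mult.continuous_on continuous_on_matrix_inv) auto
  obtain X where X: "X a = mat 1"
    "\<And>t. a \<le> t \<Longrightarrow> (X has_vector_derivative M t ** X t) (at t within {a..})"
    using linear_ode_solution_exists[where init = "mat 1", OF bounded_bilinear_matrix_mult M] by blast
  \<comment> \<open>The candidate for the inverse of \<open>X\<close> solves the equation
    \<open>Y' = - Y M\<close>, with the coefficient on the right; \<open>Y X\<close> then has
    derivative 0 and stays at the identity.\<close>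
  obtain Y :: "real \<Rightarrow> real ^ 'n ^ 'n" where Y: "Y a = mat 1"
    "\<And>t. a \<le> t \<Longrightarrow> (Y has_vector_derivative Y t ** (- M t)) (at t within {a..})"
    using linear_ode_solution_exists[where init = "mat 1", OF bounded_bilinear.flip[OF bounded_bilinear_matrix_mult]
        continuous_on_minus[OF M]] by blast
  have "((\<lambda>t. Y t ** X t) has_vector_derivative 0) (at t within {a..})" if "a \<le> t" for t
    using matrix_mult.has_vector_derivative[OF Y(2) X(2), OF that that]
    by (simp add: matrix_mult.minus_left matrix_mult.minus_right matrix_mul_assoc)
  then have YX: "Y t ** X t = mat 1" if "a \<le> t" for t
    using constant_if_derivative_zero[of a "\<lambda>t. Y t ** X t" t] that X(1) Y(1) by simp
  then have XY: "X t ** Y t = mat 1" if "a \<le> t" for t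
    using that by (simp add: matrix_left_right_inverse)
  have "((\<lambda>t. Y t ** P t ** transpose (Y t)) has_vector_derivative 0) (at t within {a..})"
    if t: "a \<le> t" for t
  proof -
    have "((\<lambda>t. Y t ** P t) has_vector_derivative Y t ** transpose (N t)) (at t within {a..})"
      using matrix_mult.has_vector_derivative[OF Y(2) P, OF t t] MP[OF t]
      by (simp add: matrix_mult.minus_left matrix_mult.minus_right matrix_add_ldistrib
          flip: matrix_mul_assoc)
    from matrix_mult.has_vector_derivative[OF this has_vector_derivative_transpose[OF Y(2)[OF t]]]
    have "((\<lambda>t. Y t ** P t ** transpose (Y t)) has_vector_derivative
        Y t ** transpose (N t) ** transpose (Y t) - Y t ** (P t ** transpose (M t)) ** transpose (Y t))
        (at t within {a..})"
      by (simp add: matrix_mult.minus_left matrix_mult.minus_right matrix_transpose_mul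
          transpose_linear_simps matrix_mul_assoc)
    then show ?thesis by (simp add: PM[OF t])
  qed
  then have YPY: "Y t ** P t ** transpose (Y t) = P a" if "a \<le> t" for t
    using constant_if_derivative_zero[of a "\<lambda>t. Y t ** P t ** transpose (Y t)" t] that Y(1) by simp
  define L where "L t = X t ** L0" for t
  have "L t ** transpose (L t) = P t" if t: "a \<le> t" for t
  proof -
    have "L t ** transpose (L t) = X t ** (L0 ** transpose L0) ** transpose (X t)"
      by (simp add: L_def matrix_transpose_mul matrix_mul_assoc)
    also have "\<dots> = (X t ** Y t) ** P t ** transpose (X t ** Y t)"
      by (simp add: L0 flip: YPY[OF t]) (simp add: matrix_transpose_mul matrix_mul_assoc)
    finally show ?thesis by (simp add: XY[OF t])
  qed
  moreover have "(L has_vector_derivative N t ** matrix_inv (P t) ** L t) (at t within {a..})"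
    if t: "a \<le> t" for t
    using matrix_mult.has_vector_derivative[OF X(2) has_vector_derivative_const[of L0], OF t]
    by (simp add: L_def[abs_def] M_def matrix_mul_assoc)
  ultimately show ?thesis by (rule that[of L])
qed

section \<open>Positive definite matrices as Gram matrices\<close>

lemma positive_definite_invertible:
  assumes "positive_definite M"
  shows "invertible M"
  unfolding invertible_left_inverse matrix_left_invertible_ker
  using assms by (force simp: positive_definite_def)

text \<open>The quadratic form of \<open>L L^T\<close> at \<open>x\<close> is the squared length of
  \<open>L^T x\<close>, and \<open>L^T\<close> is injective.\<close>

lemma positive_definite_mult_transpose:
  fixes L :: "real ^ 'n ^ 'n"
  assumes "invertible L"
  shows "positive_definite (L ** transpose L)"
  unfolding positive_definite_def
proof (intro allI impI)
  fix x :: "real ^ 'n" assume "x \<noteq> 0"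
  then have "transpose L *v x \<noteq> 0"
    using injD[OF inj_matrix_vector_mult[OF transpose_invertible[OF assms]], of x 0] by auto
  moreover have "x \<bullet> ((L ** transpose L) *v x) = (transpose L *v x) \<bullet> (transpose L *v x)"
    using dot_lmul_matrix[of x L "transpose L *v x"] by (simp flip: matrix_vector_mul_assoc)
  ultimately show "x \<bullet> ((L ** transpose L) *v x) > 0"
    by simp
qed

lemma positive_definite_gram:
  fixes S :: "real ^ 'n ^ 'n"
  assumes S: "positive_definite S" and sym: "transpose S = S"
  obtains L :: "real ^ 'n ^ 'n" where "L ** transpose L = S"
proof -
  \<comment> \<open>Transport the factorization of the identity along a path of positive definite matrices
      from the identity to \<open>S\<close> that is defined for all \<open>t \<ge> 0\<close>.\<close>
  define P where "P t = (1 - t)\<^sup>2 *\<^sub>R mat 1 + t *\<^sub>R S" for t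
  \<comment> \<open>Half the derivative of the symmetric \<open>P\<close>, so that
    \<open>N + N^T = P'\<close>. The square in \<open>P\<close> keeps the weight of the identity
    nonnegative beyond \<open>t = 1\<close> too, where the weight \<open>1 - t\<close> of a straight
    segment would turn negative.\<close>
  define N where "N t = (t - 1) *\<^sub>R mat 1 + (1/2) *\<^sub>R S" for t
  have tN: "N t + transpose (N t) = (2 * (t - 1)) *\<^sub>R mat 1 + S" for t
    by (simp add: N_def transpose_linear_simps sym vec_eq_iff algebra_simps)
  have "invertible (P t)" if "t \<ge> 0" for t
  proof (rule positive_definite_invertible, unfold positive_definite_def, intro allI impI)
    fix x :: "real ^ 'n" assume "x \<noteq> 0"
    then have "x \<bullet> x > 0" "x \<bullet> (S *v x) > 0"
      using S by (auto simp: positive_definite_def)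
    moreover have "x \<bullet> (P t *v x) = (1 - t)\<^sup>2 * (x \<bullet> x) + t * (x \<bullet> (S *v x))"
      by (simp add: P_def matrix_vector_mult_add_rdistrib inner_add_right
          flip: scaleR_matrix_vector_assoc)
    ultimately show "x \<bullet> (P t *v x) > 0"
      using \<open>t \<ge> 0\<close> by (cases "t = 0") (auto intro: add_nonneg_pos)
  qed
  moreover have "(P has_vector_derivative N t + transpose (N t)) (at t within {0..})" for t
    unfolding P_def tN by (auto intro!: derivative_eq_intros simp: algebra_simps)
  moreover have "continuous_on {0..} N"
    unfolding N_def by (intro continuous_intros)
  moreover have "transpose (P t) = P t" for t
    by (simp add: P_def transpose_linear_simps sym)
  moreover have "mat 1 ** transpose (mat 1) = P 0"
    by (simp add: P_def)
  ultimately obtain L :: "real \<Rightarrow> real ^ 'n ^ 'n" where "\<And>t. 0 \<le> t \<Longrightarrow> L t ** transpose (L t) = P t"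
    using gram_factorization[of 0 P N "mat 1"] by metis
  from this[of 1] show ?thesis
    by (intro that[of "L 1"]) (simp add: P_def)
qed

subsection \<open>Iterated derivatives on a half-line\<close>

text \<open>Derivatives within the half-line are unique, also at the end point \<open>t = a\<close>,
  because \<open>t\<close> is a limit point of \<open>{a..t + 1}\<close>.\<close>

lemma D_eq:
  assumes "(f has_vector_derivative f') (at t within {a..})" "a \<le> t"
  shows "D a f t = f'"
proof -
  have "at t within {a..t + 1} \<noteq> bot"
    using assms(2) by (simp add: trivial_limit_within islimpt_Icc)
  with assms(1) show ?thesis
    by (simp add: D_def at_within_atLeastAtMost_eq vector_derivative_within)
qed

lemma D_works:
  assumes "f differentiable_on {a..}" "a \<le> t"
  shows "(f has_vector_derivative D a f t) (at t within {a..})"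
  using assms by (simp add: D_def differentiable_on_def vector_derivative_works)

lemma differentiable_on_if_has_vector_derivative:
  assumes "\<And>t. t \<in> X \<Longrightarrow> (f has_vector_derivative f' t) (at t within X)"
  shows "f differentiable_on X"
  using assms by (auto simp: differentiable_on_def intro: differentiableI_vector)

lemma D_cong:
  assumes "\<And>t. a \<le> t \<Longrightarrow> f t = g t" "a \<le> t"
  shows "D a f t = D a g t"
  unfolding D_def using assms by (intro vector_derivative_cong_eq) auto

text \<open>Peels off the derivative that is taken first, which is the form suited to induction on
  the order of smoothness.\<close>

lemma C_on_Suc: "C_on (Suc i) a f \<longleftrightarrow> f differentiable_on {a..} \<and> C_on i a (D a f)"
  unfolding C_on_def by (auto simp: All_less_Suc2 funpow_Suc_right simp del: funpow.simps)

lemma differentiable_on_cong: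
  "X = Y \<Longrightarrow> (\<And>x. x \<in> Y \<Longrightarrow> f x = g x) \<Longrightarrow> f differentiable_on X \<longleftrightarrow> g differentiable_on Y"
  by (auto simp: differentiable_on_def intro: differentiable_transform_within[of _ _ _ 1])

lemma C_on_cong:
  assumes "\<And>t. a \<le> t \<Longrightarrow> f t = g t"
  shows "C_on i a f \<longleftrightarrow> C_on i a g"
  using assms
proof (induction i arbitrary: f g)
  case 0
  then show ?case by (auto simp: C_on_def intro!: continuous_on_cong)
next
  case (Suc i)
  have "C_on i a (D a f) \<longleftrightarrow> C_on i a (D a g)"
    by (intro Suc.IH D_cong Suc.prems)
  moreover have "f differentiable_on {a..} \<longleftrightarrow> g differentiable_on {a..}"
    using Suc.prems by (intro differentiable_on_cong) auto
  ultimately show ?case by (simp add: C_on_Suc)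
qed

section \<open>Entrywise and matrix-valued smoothness\<close>

lemma matrix_continuous_on_iff:
  fixes M :: "'a::topological_space \<Rightarrow> real ^ 'n ^ 'm"
  shows "continuous_on X M \<longleftrightarrow> (\<forall>p q. continuous_on X (\<lambda>t. M t $ p $ q))"
proof
  assume "\<forall>p q. continuous_on X (\<lambda>t. M t $ p $ q)"
  then have "continuous_on X (\<lambda>t. \<chi> p q. M t $ p $ q)"
    by (intro continuous_on_vec_lambda) auto
  then show "continuous_on X M" by simp
qed (auto intro!: continuous_intros)

lemma matrix_differentiable_on_iff:
  fixes M :: "real \<Rightarrow> real ^ 'n ^ 'm"
  shows "M differentiable_on X \<longleftrightarrow> (\<forall>p q. (\<lambda>t. M t $ p $ q) differentiable_on X)"
  unfolding differentiable_on_def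
  by (subst differentiable_componentwise_within) (auto simp: Basis_vec_def inner_axis)

lemma D_component:
  fixes M :: "real \<Rightarrow> real ^ 'n ^ 'm"
  assumes "M differentiable_on {a..}" "a \<le> t"
  shows "D a (\<lambda>t. M t $ p $ q) t = D a M t $ p $ q"
  by (intro D_eq[OF _ assms(2)] bounded_linear.has_vector_derivative[OF bounded_linear_vec_nth]
      D_works[OF assms])

lemma mat_C_0_iff: "M \<in> mat_C 0 a \<longleftrightarrow> continuous_on {a..} M"
  by (simp add: mat_C_def C_on_def matrix_continuous_on_iff)

text \<open>\<open>mat_C\<close> speaks of derivatives of entries, the proof of derivatives of
  matrices. The two agree on the half-line only, hence the appeal to congruence instead of
  rewriting.\<close>

lemma mat_C_Suc_iff: "M \<in> mat_C (Suc i) a \<longleftrightarrow> M differentiable_on {a..} \<and> D a M \<in> mat_C i a"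
proof -
  have "C_on i a (D a (\<lambda>t. M t $ p $ q)) \<longleftrightarrow> C_on i a (\<lambda>t. D a M t $ p $ q)"
    if "M differentiable_on {a..}" for p q
    by (intro C_on_cong D_component that)
  then show ?thesis
    by (auto simp: mat_C_def C_on_Suc matrix_differentiable_on_iff)
qed

lemma mat_C_cong:
  assumes "\<And>t. a \<le> t \<Longrightarrow> M t = N t"
  shows "M \<in> mat_C i a \<longleftrightarrow> N \<in> mat_C i a"
proof -
  have "C_on i a (\<lambda>t. M t $ p $ q) \<longleftrightarrow> C_on i a (\<lambda>t. N t $ p $ q)" for p q
    using assms by (intro C_on_cong) simp
  then show ?thesis by (simp add: mat_C_def)
qed

lemma mat_C_SucI:
  assumes "\<And>t. a \<le> t \<Longrightarrow> (M has_vector_derivative M' t) (at t within {a..})"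
    and "M' \<in> mat_C i a"
  shows "M \<in> mat_C (Suc i) a"
proof -
  have "D a M \<in> mat_C i a \<longleftrightarrow> M' \<in> mat_C i a"
    by (intro mat_C_cong D_eq assms(1))
  moreover have "M differentiable_on {a..}"
    using assms(1) by (intro differentiable_on_if_has_vector_derivative) auto
  ultimately show ?thesis
    using assms(2) by (simp add: mat_C_Suc_iff)
qed

lemma bdd_above_norm_image_iff:
  fixes f :: "'a \<Rightarrow> 'b::real_normed_vector"
  shows "bdd_above ((\<lambda>t. norm (f t)) ` X) \<longleftrightarrow> bounded (f ` X)"
  by (auto simp: bounded_iff bdd_above_def)

lemma bounded_transpose:
  fixes f :: "'a \<Rightarrow> real ^ 'n ^ 'm"
  assumes "bounded (f ` X)"
  shows "bounded ((\<lambda>t. transpose (f t)) ` X)"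
  using bounded_linear_image[OF assms bounded_linear_transpose] by (simp add: image_image)

lemma continuous_on_transpose:
  fixes f :: "'a::topological_space \<Rightarrow> real ^ 'n ^ 'm"
  shows "continuous_on X f \<Longrightarrow> continuous_on X (\<lambda>t. transpose (f t))"
  by (rule bounded_linear.continuous_on[OF bounded_linear_transpose])

section \<open>Symmetry of the transformed coefficient\<close>

text \<open>Congruence by the invertible \<open>L\<close> preserves and reflects symmetry, so
  \<open>W\<close> may be replaced by \<open>Z = L W L^T\<close>. In \<open>Z - Z^T\<close> the
  symmetric terms \<open>S1\<close> and \<open>L1 L1^T\<close> cancel, and what remains is the left
  side of the equation. The argument is pointwise: \<open>L1\<close>, \<open>L2\<close>,
  \<open>S1\<close>, \<open>K1\<close> stand for values of derivatives.\<close>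

lemma symmetric_coefficient_iff:
  fixes L L1 L2 A B S S1 K K1 :: "real ^ 'n ^ 'n"
  assumes L: "invertible L"
    and N: "L1 ** transpose L = S + K"
    and N1: "L2 ** transpose L + L1 ** transpose L1 = S1 + K1"
    and sym: "transpose S = S" "transpose S1 = S1" "transpose K = - K" "transpose K1 = - K1"
  shows "symmetric_matrix (matrix_inv L ** (L2 + A ** L1 + B ** L)) \<longleftrightarrow>
    2 *\<^sub>R K1 + A ** K + K ** transpose A + A ** S - S ** transpose A
      + B ** (L ** transpose L) - (L ** transpose L) ** transpose B = 0"
    (is "symmetric_matrix ?W \<longleftrightarrow> ?E = 0")
proof -
  define Z where "Z = (L2 + A ** L1 + B ** L) ** transpose L"
  have LT: "invertible (transpose L)"
    using L by (rule transpose_invertible)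
  have LWL: "L ** ?W ** transpose L = Z"
    by (simp add: Z_def matrix_inv_cancel[OF L])
  have "symmetric_matrix ?W \<longleftrightarrow> L ** ?W ** transpose L = L ** transpose ?W ** transpose L"
  proof
    assume "L ** ?W ** transpose L = L ** transpose ?W ** transpose L"
    then have "L ** ?W = L ** transpose ?W"
      by (metis matrix_inv_cancel(3)[OF LT])
    then show "symmetric_matrix ?W"
      unfolding symmetric_matrix_def by (metis matrix_inv_cancel(2)[OF L])
  qed (simp add: symmetric_matrix_def)
  also have "L ** transpose ?W ** transpose L = transpose Z"
    by (simp only: LWL[symmetric] matrix_transpose_mul transpose_transpose matrix_mul_assoc)
  also have "L ** ?W ** transpose L = transpose Z \<longleftrightarrow> Z - transpose Z = 0"
    by (simp add: LWL)
  also have "Z - transpose Z = ?E"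
  proof -
    \<comment> \<open>The second derivative is eliminated through \<open>N1\<close>:
      \<open>L2 L^T = S1 + K1 - L1 L1^T\<close>.\<close>
    have Z: "Z = S1 + K1 - L1 ** transpose L1 + A ** (S + K) + B ** (L ** transpose L)"
      unfolding N[symmetric] N1[symmetric] Z_def
      by (simp add: matrix_add_rdistrib matrix_mul_assoc)
    have ZT: "transpose Z = S1 - K1 - L1 ** transpose L1 + (S - K) ** transpose A
        + L ** transpose L ** transpose B"
      unfolding Z by (simp add: transpose_linear_simps matrix_transpose_mul sym)
    show ?thesis
      unfolding ZT unfolding Z
      by (simp add: matrix_add_ldistrib matrix_mult.diff_left scaleR_2)
  qed
  finally show ?thesis .
qed

text \<open>Transposition is bounded linear and so commutes with \<open>D\<close>. The factor
  \<open>c\<close> treats symmetric (\<open>c = 1\<close>) and skew-symmetric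
  (\<open>c = -1\<close>) functions at once.\<close>

lemma symmetric_D:
  fixes M :: "real \<Rightarrow> real ^ 'n ^ 'n"
  assumes "M differentiable_on {a..}" "\<And>t. a \<le> t \<Longrightarrow> transpose (M t) = c *\<^sub>R M t" "a \<le> t"
  shows "transpose (D a M t) = c *\<^sub>R D a M t"
proof -
  have "transpose (D a M t) = D a (\<lambda>t. transpose (M t)) t"
    by (rule D_eq[symmetric, OF has_vector_derivative_transpose[OF D_works[OF assms(1,3)]] assms(3)])
  also have "\<dots> = D a (\<lambda>t. c *\<^sub>R M t) t"
    by (intro D_cong assms)
  also have "\<dots> = c *\<^sub>R D a M t"
    by (rule D_eq[OF bounded_linear.has_vector_derivative[OF bounded_linear_scaleR_right
          D_works[OF assms(1,3)]] assms(3)])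
  finally show ?thesis .
qed

section \<open>The integral function \<open>Lambda\<close>\<close>

lemma Lambda_has_vector_derivative:
  assumes "continuous_on {a..} S" "a \<le> t"
  shows "(Lambda a S S0 has_vector_derivative 2 *\<^sub>R S t) (at t within {a..})"
  unfolding Lambda_def
  using indefinite_integral_has_vector_derivative[OF assms]
  by (auto intro!: derivative_eq_intros)

text \<open>Fundamental theorem of calculus; it identifies \<open>L L^T\<close> with
  \<open>Lambda\<close> once its derivative is known to be \<open>2 S\<close>.\<close>

lemma Lambda_eq:
  assumes "\<And>t. a \<le> t \<Longrightarrow> (P has_vector_derivative 2 *\<^sub>R S t) (at t within {a..})" "a \<le> t"
  shows "Lambda a S (P a) t = P t"
proof -
  have "(P has_vector_derivative 2 *\<^sub>R S s) (at s within {a..t})" if "s \<in> {a..t}" for s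
    using that by (intro has_vector_derivative_within_subset[OF assms(1)]) auto
  then have "((\<lambda>t. 2 *\<^sub>R S t) has_integral P t - P a) {a..t}"
    using assms(2) by (intro fundamental_theorem_of_calculus)
  from integral_unique[OF this] show ?thesis
    by (simp add: Lambda_def)
qed

text \<open>Used with the trace, to reach the trace condition, and with transposition, to see that
  \<open>Lambda\<close> is symmetric.\<close>

lemma bounded_linear_Lambda:
  fixes S :: "real \<Rightarrow> real ^ 'n ^ 'n"
  assumes "bounded_linear h" "continuous_on {a..} S"
  shows "h (Lambda a S S0 t) = 2 *\<^sub>R integral {a..t} (\<lambda>t. h (S t)) + h S0"
proof -
  interpret h: bounded_linear h by (fact assms(1))
  have "S integrable_on {a..t}"
    by (intro integrable_continuous_real continuous_on_subset[OF assms(2)]) auto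
  from integral_linear[OF this assms(1)] show ?thesis
    by (simp add: Lambda_def h.add h.scaleR o_def)
qed

subsection \<open>The two implications\<close>

text \<open>The witnesses are the symmetric and skew-symmetric parts \<open>S\<close>,
  \<open>K\<close> of \<open>L' L^T\<close>, together with \<open>S0 = L(t0) L(t0)^T\<close>, which
  is positive definite because \<open>L(t0)\<close> is invertible.\<close>

lemma equation_if_L_equivalent:
  fixes A B :: "real \<Rightarrow> real ^ 'n ^ 'n"
  assumes k: "k \<le> 2"
    and equiv: "L_equivalent k t0 A B V W"
    and W: "\<And>t. t0 \<le> t \<Longrightarrow> symmetric_matrix (W t)"
  shows "\<exists>S S0 K.
       S \<in> mat_C 1 t0 \<and> (\<forall>t\<ge>t0. symmetric_matrix (S t)) \<and>
       symmetric_matrix S0 \<and> positive_definite S0 \<and>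
       K differentiable_on {t0..} \<and> (\<forall>t\<ge>t0. skew_symmetric_matrix (K t)) \<and>
       (\<forall>t\<ge>t0.
          2 *\<^sub>R D t0 K t + A t ** K t + K t ** transpose (A t)
          + A t ** S t - S t ** transpose (A t)
          + B t ** Lambda t0 S S0 t - Lambda t0 S S0 t ** transpose (B t) = 0) \<and>
       (\<exists>\<mu>>0. \<exists>\<eta>>0. \<forall>t\<ge>t0.
          \<bar>2 * integral {t0..t} (\<lambda>\<nu>. trace (S \<nu>)) + trace S0\<bar> \<le> \<mu>\<^sup>2 \<and>
          det (2 *\<^sub>R integral {t0..t} S + S0) \<ge> \<eta>\<^sup>2) \<and>
       (k \<noteq> 0 \<longrightarrow> (\<forall>i\<in>{0..k - 1}.
          bdd_above ((\<lambda>t. norm ((D t0 ^^ i) K t)) ` {t0..}) \<and>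
          bdd_above ((\<lambda>t. norm ((D t0 ^^ i) S t)) ` {t0..})))"
proof -
  obtain L where L: "L_matrix k t0 L"
    and WL: "\<And>t. t0 \<le> t \<Longrightarrow>
      W t = matrix_inv (L t) ** ((D t0 ^^ 2) L t + A t ** D t0 L t + B t ** L t)"
    using equiv unfolding L_equivalent_def by auto
  define L1 L2 where "L1 = D t0 L" and "L2 = D t0 (D t0 L)"
  have "L \<in> mat_C 2 t0" using L by (simp add: L_matrix_def)
  then have diff: "L differentiable_on {t0..}" "L1 differentiable_on {t0..}"
    and contL2: "continuous_on {t0..} L2"
    by (auto simp: numeral_2_eq_2 mat_C_Suc_iff mat_C_0_iff L1_def L2_def)
  have dL: "(L has_vector_derivative L1 t) (at t within {t0..})"
    and dL1: "(L1 has_vector_derivative L2 t) (at t within {t0..})" if "t0 \<le> t" for t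
    using D_works[OF diff(1) that] D_works[OF diff(2) that] by (simp_all add: L1_def L2_def)
  have contL: "continuous_on {t0..} L" "continuous_on {t0..} L1"
    using diff by (auto intro: differentiable_imp_continuous_on)
  define P N N1 where "P t = L t ** transpose (L t)" and "N t = L1 t ** transpose (L t)"
    and "N1 t = L2 t ** transpose (L t) + L1 t ** transpose (L1 t)" for t
  \<comment> \<open>Splitting into symmetric and skew-symmetric parts commutes with differentiation,
    so \<open>S1\<close> and \<open>K1\<close> are the derivatives of \<open>S\<close> and
    \<open>K\<close>.\<close>
  define S K S1 K1 where "S t = (1/2) *\<^sub>R (N t + transpose (N t))"
    and "K t = (1/2) *\<^sub>R (N t - transpose (N t))"
    and "S1 t = (1/2) *\<^sub>R (N1 t + transpose (N1 t))"
    and "K1 t = (1/2) *\<^sub>R (N1 t - transpose (N1 t))" for t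
  have SK: "N t = S t + K t" "N1 t = S1 t + K1 t" for t
    by (simp_all add: S_def K_def S1_def K1_def scaleR_right_distrib scaleR_right_diff_distrib
        flip: scaleR_left_distrib)
  have sym: "transpose (S t) = S t" "transpose (S1 t) = S1 t"
    "transpose (K t) = - K t" "transpose (K1 t) = - K1 t" for t
    by (simp_all add: S_def K_def S1_def K1_def transpose_linear_simps add.commute
        flip: scaleR_minus_right)
  have dN: "(N has_vector_derivative N1 t) (at t within {t0..})" if "t0 \<le> t" for t
    using matrix_mult.has_vector_derivative[OF dL1 has_vector_derivative_transpose[OF dL], OF that that]
    by (simp add: N_def[abs_def] N1_def add.commute)
  have dP: "(P has_vector_derivative 2 *\<^sub>R S t) (at t within {t0..})" if "t0 \<le> t" for t
    using matrix_mult.has_vector_derivative[OF dL has_vector_derivative_transpose[OF dL], OF that that]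
    by (simp add: P_def[abs_def] S_def N_def matrix_transpose_mul add.commute)
  have dS: "(S has_vector_derivative S1 t) (at t within {t0..})"
    and dK: "(K has_vector_derivative K1 t) (at t within {t0..})" if "t0 \<le> t" for t
    unfolding S_def[abs_def] K_def[abs_def] S1_def K1_def
    by (intro bounded_linear.has_vector_derivative[OF bounded_linear_scaleR_right]
        has_vector_derivative_add has_vector_derivative_diff has_vector_derivative_transpose dN that)+
  have contN1: "continuous_on {t0..} N1"
    unfolding N1_def[abs_def]
    by (intro continuous_on_add matrix_mult.continuous_on continuous_on_transpose contL contL2)
  have "continuous_on {t0..} S1"
    unfolding S1_def[abs_def] by (intro continuous_intros continuous_on_transpose contN1)
  then have S_C1: "S \<in> mat_C 1 t0"
    using mat_C_SucI[OF dS, of 0] by (simp add: mat_C_0_iff)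
  then have contS: "continuous_on {t0..} S"
    by (auto simp: mat_C_Suc_iff intro: differentiable_imp_continuous_on)
  have DS: "D t0 S t = S1 t" and DK: "D t0 K t = K1 t" if "t0 \<le> t" for t
    using D_eq[OF dS] D_eq[OF dK] that by auto
  have Lam: "Lambda t0 S (P t0) t = P t" if "t0 \<le> t" for t
    using Lambda_eq[OF dP] that by simp
  obtain \<eta> where eta: "\<eta> > 0" "\<And>t. t0 \<le> t \<Longrightarrow> \<bar>det (L t)\<bar> > \<eta>"
    using L by (auto simp: L_matrix_def)
  then have inv: "invertible (L t)" if "t0 \<le> t" for t
    using that by (force simp: invertible_det_nz)
  have bdd: "bounded ((D t0 ^^ i) L ` {t0..})" if "i \<le> k" for i
    using L that bdd_above_norm_image_iff[of "(D t0 ^^ i) L" "{t0..}"] by (simp add: L_matrix_def)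
  have eqn: "2 *\<^sub>R D t0 K t + A t ** K t + K t ** transpose (A t)
      + A t ** S t - S t ** transpose (A t)
      + B t ** Lambda t0 S (P t0) t - Lambda t0 S (P t0) t ** transpose (B t) = 0"
    if t: "t0 \<le> t" for t
    using W[OF t] symmetric_coefficient_iff[OF inv[OF t] SK(1)[of t, unfolded N_def]
        SK(2)[of t, unfolded N1_def] sym]
    by (simp add: WL[OF t] DK[OF t] Lam[OF t, unfolded P_def] P_def L1_def L2_def numeral_2_eq_2)
  obtain c where c: "c > 0" "\<And>t. t0 \<le> t \<Longrightarrow> norm (L t) \<le> c"
    using bdd[of 0] by (auto simp: bounded_pos)
  \<comment> \<open>The norm bound \<open>c\<close> on \<open>L\<close> serves as
    \<open>\<mu>\<close>, and the lower bound on the determinant of \<open>L\<close> is reused as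
    \<open>\<eta>\<close>: the trace of \<open>P\<close> is the squared norm of \<open>L\<close>,
    and its determinant is the square of that of \<open>L\<close>.\<close>
  have bounds: "\<bar>2 * integral {t0..t} (\<lambda>\<nu>. trace (S \<nu>)) + trace (P t0)\<bar> \<le> c\<^sup>2 \<and>
      det (2 *\<^sub>R integral {t0..t} S + P t0) \<ge> \<eta>\<^sup>2" if t: "t0 \<le> t" for t
  proof
    have "2 * integral {t0..t} (\<lambda>\<nu>. trace (S \<nu>)) + trace (P t0) = trace (P t)"
      using bounded_linear_Lambda[OF bounded_linear_trace contS, of "P t0" t] by (simp add: Lam t)
    also have "\<dots> = (norm (L t))\<^sup>2"
      by (simp add: P_def trace_mult_transpose)
    finally show "\<bar>2 * integral {t0..t} (\<lambda>\<nu>. trace (S \<nu>)) + trace (P t0)\<bar> \<le> c\<^sup>2"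
      using c(2)[OF t] by (simp add: power_mono)
    have "\<eta>\<^sup>2 \<le> \<bar>det (L t)\<bar>\<^sup>2"
      using eta(1) eta(2)[OF t] by (intro power_mono) auto
    also have "\<dots> = det (P t)"
      by (simp add: P_def det_mul power2_eq_square)
    finally show "det (2 *\<^sub>R integral {t0..t} S + P t0) \<ge> \<eta>\<^sup>2"
      using Lam[OF t] by (simp add: Lambda_def)
  qed
  have bddSK: "bounded ((\<lambda>t. (1/2) *\<^sub>R (f t + transpose (f t))) ` {t0..})"
    "bounded ((\<lambda>t. (1/2) *\<^sub>R (f t - transpose (f t))) ` {t0..})"
    if "bounded (f ` {t0..})" for f :: "real \<Rightarrow> real ^ 'n ^ 'n"
    using that by (intro bounded_scaleR_comp bounded_plus_comp bounded_minus_comp bounded_transpose; simp)+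
  \<comment> \<open>The \<open>i\<close>-th derivatives of \<open>S\<close> and \<open>K\<close>
    involve derivatives of \<open>L\<close> up to order \<open>i + 1\<close>, hence the range up to
    \<open>k - 1\<close>.\<close>
  have bddD: "bdd_above ((\<lambda>t. norm ((D t0 ^^ i) K t)) ` {t0..}) \<and>
      bdd_above ((\<lambda>t. norm ((D t0 ^^ i) S t)) ` {t0..})" if "k \<noteq> 0" "i \<in> {0..k - 1}" for i
  proof (cases i)
    case 0
    have "bounded (N ` {t0..})"
      unfolding N_def[abs_def] using bdd[of 0] bdd[of 1] that
      by (intro bounded_matrix_mult bounded_transpose) (auto simp: L1_def)
    from bddSK[OF this] have "bounded (S ` {t0..})" "bounded (K ` {t0..})"
      by (simp_all add: S_def[abs_def] K_def[abs_def])
    with 0 show ?thesis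
      by (simp add: bdd_above_norm_image_iff)
  next
    case (Suc j)
    with that k have "i = 1" "k = 2" by auto
    have "bounded (N1 ` {t0..})"
      unfolding N1_def[abs_def] using bdd[of 0] bdd[of 1] bdd[of 2] \<open>k = 2\<close>
      by (intro bounded_plus_comp bounded_matrix_mult bounded_transpose)
        (auto simp: L1_def L2_def numeral_2_eq_2)
    from bddSK[OF this] have "bounded (S1 ` {t0..})" "bounded (K1 ` {t0..})"
      by (simp_all add: S1_def[abs_def] K1_def[abs_def])
    moreover have "D t0 S ` {t0..} = S1 ` {t0..}" "D t0 K ` {t0..} = K1 ` {t0..}"
      using DS DK by (auto intro!: image_cong)
    ultimately show ?thesis
      using \<open>i = 1\<close> by (simp add: bdd_above_norm_image_iff)
  qed
  show ?thesis
  proof (rule exI[of _ S], rule exI[of _ "P t0"], rule exI[of _ K], intro conjI allI impI ballI)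
    show "K differentiable_on {t0..}"
      using dK by (intro differentiable_on_if_has_vector_derivative) auto
    show "symmetric_matrix (P t0)"
      by (simp add: symmetric_matrix_def P_def matrix_transpose_mul)
    show "positive_definite (P t0)"
      unfolding P_def by (intro positive_definite_mult_transpose inv order_refl)
    show "symmetric_matrix (S t)" "skew_symmetric_matrix (K t)" for t
      unfolding symmetric_matrix_def skew_symmetric_matrix_def by (simp_all add: sym)
    show "\<exists>\<mu>>0. \<exists>\<eta>>0. \<forall>t\<ge>t0.
        \<bar>2 * integral {t0..t} (\<lambda>\<nu>. trace (S \<nu>)) + trace (P t0)\<bar> \<le> \<mu>\<^sup>2 \<and>
        det (2 *\<^sub>R integral {t0..t} S + P t0) \<ge> \<eta>\<^sup>2"
      using bounds c(1) eta(1) by blast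
  qed (simp_all add: S_C1[simplified] eqn bddD)
qed

text \<open>Apply the Gram factorization to \<open>P = Lambda\<close> and \<open>N = S + K\<close>.
  The determinant condition makes \<open>P\<close> invertible, and \<open>S0\<close> has a Gram
  factor to start from. The resulting \<open>L\<close> satisfies \<open>L L^T = P\<close> and
  \<open>L' L^T = N\<close>, so the symmetry criterion turns the equation into symmetry of
  \<open>W\<close>.\<close>

lemma L_equivalent_if_equation:
  fixes A B S K :: "real \<Rightarrow> real ^ 'n ^ 'n"
  assumes k: "k \<le> 2"
    and A: "A \<in> mat_C 0 t0" and B: "B \<in> mat_C 0 t0"
    and S: "S \<in> mat_C 1 t0" "\<And>t. t0 \<le> t \<Longrightarrow> symmetric_matrix (S t)"
    and S0: "symmetric_matrix S0" "positive_definite S0"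
    and K: "K differentiable_on {t0..}" "\<And>t. t0 \<le> t \<Longrightarrow> skew_symmetric_matrix (K t)"
    and eqn: "\<And>t. t0 \<le> t \<Longrightarrow>
          2 *\<^sub>R D t0 K t + A t ** K t + K t ** transpose (A t)
          + A t ** S t - S t ** transpose (A t)
          + B t ** Lambda t0 S S0 t - Lambda t0 S S0 t ** transpose (B t) = 0"
    and trace: "\<And>t. t0 \<le> t \<Longrightarrow>
          \<bar>2 * integral {t0..t} (\<lambda>\<nu>. trace (S \<nu>)) + trace S0\<bar> \<le> \<mu>\<^sup>2"
    and "\<eta> > 0" and det: "\<And>t. t0 \<le> t \<Longrightarrow> det (2 *\<^sub>R integral {t0..t} S + S0) \<ge> \<eta>\<^sup>2"
    and bdd: "\<And>i. i < k \<Longrightarrow>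
          bdd_above ((\<lambda>t. norm ((D t0 ^^ i) K t)) ` {t0..}) \<and>
          bdd_above ((\<lambda>t. norm ((D t0 ^^ i) S t)) ` {t0..})"
  shows "\<exists>V W. L_equivalent k t0 A B V W \<and> (\<forall>t\<ge>t0. symmetric_matrix (W t))"
proof -
  define P where "P = Lambda t0 S S0"
  define N N1 where "N t = S t + K t" and "N1 t = D t0 S t + D t0 K t" for t
  have contAB: "continuous_on {t0..} A" "continuous_on {t0..} B"
    using A B by (simp_all add: mat_C_0_iff)
  have diffS: "S differentiable_on {t0..}" and contDS: "continuous_on {t0..} (D t0 S)"
    using S(1) by (auto simp: mat_C_Suc_iff mat_C_0_iff)
  have contSK: "continuous_on {t0..} S" "continuous_on {t0..} K"
    using diffS K(1) by (auto intro: differentiable_imp_continuous_on)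
  have symS: "transpose (S t) = S t" and symK: "transpose (K t) = - K t" if "t0 \<le> t" for t
    using S(2)[OF that] K(2)[OF that]
    unfolding symmetric_matrix_def skew_symmetric_matrix_def by (metis minus_minus)+
  have symS0: "transpose S0 = S0"
    using S0(1) unfolding symmetric_matrix_def by (rule sym)
  have symDS: "transpose (D t0 S t) = D t0 S t" and symDK: "transpose (D t0 K t) = - D t0 K t"
    if "t0 \<le> t" for t
    using symmetric_D[OF diffS, of 1 t] symmetric_D[OF K(1), of "-1" t] symS symK that by simp_all
  have dP: "(P has_vector_derivative 2 *\<^sub>R S t) (at t within {t0..})" if "t0 \<le> t" for t
    unfolding P_def using Lambda_has_vector_derivative[OF contSK(1) that] .
  then have contP: "continuous_on {t0..} P"
    by (intro continuous_on_vector_derivative) auto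
  have N_sym: "N t + transpose (N t) = 2 *\<^sub>R S t" if "t0 \<le> t" for t
    using that by (simp add: N_def transpose_linear_simps symS symK scaleR_2)
  have dN: "(N has_vector_derivative N1 t) (at t within {t0..})" if "t0 \<le> t" for t
    unfolding N_def[abs_def] N1_def[abs_def]
    by (intro has_vector_derivative_add D_works diffS K(1) that)
  have contN: "continuous_on {t0..} N"
    unfolding N_def[abs_def] by (intro continuous_intros contSK)
  have symP: "transpose (P t) = P t" if "t0 \<le> t" for t
  proof -
    have "transpose (P t) = 2 *\<^sub>R integral {t0..t} (\<lambda>t. transpose (S t)) + transpose S0"
      unfolding P_def by (rule bounded_linear_Lambda[OF bounded_linear_transpose contSK(1)])
    also have "integral {t0..t} (\<lambda>t. transpose (S t)) = integral {t0..t} S"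
      by (intro integral_cong) (simp add: symS)
    finally show ?thesis
      by (simp add: P_def Lambda_def symS0)
  qed
  have detP: "det (P t) \<ge> \<eta>\<^sup>2" if "t0 \<le> t" for t
    using det[OF that] by (simp add: P_def Lambda_def)
  have invP: "invertible (P t)" if "t0 \<le> t" for t
    using detP[OF that] \<open>\<eta> > 0\<close> by (auto simp: invertible_det_nz)
  obtain L0 :: "real ^ 'n ^ 'n" where "L0 ** transpose L0 = S0"
    using positive_definite_gram[OF S0(2) symS0] .
  then have L0: "L0 ** transpose L0 = P t0"
    by (simp add: P_def Lambda_def)
  have dP': "(P has_vector_derivative N t + transpose (N t)) (at t within {t0..})" if "t0 \<le> t" for t
    using dP[OF that] by (simp add: N_sym[OF that])
  obtain L :: "real \<Rightarrow> real ^ 'n ^ 'n"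
    where LL: "\<And>t. t0 \<le> t \<Longrightarrow> L t ** transpose (L t) = P t"
      and dL: "\<And>t. t0 \<le> t \<Longrightarrow>
        (L has_vector_derivative N t ** matrix_inv (P t) ** L t) (at t within {t0..})"
    using gram_factorization[OF dP' contN invP symP L0] by blast
  have detL: "\<eta> \<le> \<bar>det (L t)\<bar>" if "t0 \<le> t" for t
  proof (rule power2_le_imp_le)
    show "\<eta>\<^sup>2 \<le> \<bar>det (L t)\<bar>\<^sup>2"
      using detP[OF that] by (simp add: det_mul power2_eq_square flip: LL[OF that])
  qed simp
  then have invL: "invertible (L t)" if "t0 \<le> t" for t
    using that \<open>\<eta> > 0\<close> by (force simp: invertible_det_nz)
  have invLT: "invertible (transpose (L t))" if "t0 \<le> t" for t
    using invL[OF that] by (rule transpose_invertible)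
  define L1 L2 where "L1 = D t0 L" and "L2 = D t0 (D t0 L)"
  have L1_eq: "L1 t = N t ** matrix_inv (P t) ** L t" if "t0 \<le> t" for t
    unfolding L1_def using dL[OF that] that by (rule D_eq)
  have dL: "(L has_vector_derivative L1 t) (at t within {t0..})" if "t0 \<le> t" for t
    using dL L1_eq that by simp
  \<comment> \<open>The formula for \<open>L1\<close> is a product of differentiable factors. The
    value of its derivative need not be computed: by uniqueness it is \<open>L2 t\<close>.\<close>
  have dL1: "(L1 has_vector_derivative L2 t) (at t within {t0..})" if t: "t0 \<le> t" for t
  proof -
    have "((\<lambda>t. matrix_inv (P t)) has_vector_derivative
        - (matrix_inv (P t) ** (2 *\<^sub>R S t) ** matrix_inv (P t))) (at t within {t0..})"
      using dP[OF t] t contP invP by (intro matrix_inv_has_vector_derivative) auto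
    from matrix_mult.has_vector_derivative[OF matrix_mult.has_vector_derivative[OF dN[OF t] this] dL[OF t]]
    obtain L' where "((\<lambda>t. N t ** matrix_inv (P t) ** L t) has_vector_derivative L') (at t within {t0..})"
      by blast
    then have "(L1 has_vector_derivative L') (at t within {t0..})"
      by (rule has_vector_derivative_transform[rotated 2]) (use t L1_eq in auto)
    moreover from D_eq[OF this t] have "L' = L2 t"
      by (simp add: L1_def L2_def)
    ultimately show ?thesis by simp
  qed
  have N_eq: "L1 t ** transpose (L t) = N t" if "t0 \<le> t" for t
    using matrix_inv_cancel(4)[OF invP[OF that]]
    by (simp add: L1_eq[OF that] LL[OF that] flip: matrix_mul_assoc)
  have N1_eq: "L2 t ** transpose (L t) + L1 t ** transpose (L1 t) = N1 t" if t: "t0 \<le> t" for t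
  proof -
    have "D t0 (\<lambda>t. L1 t ** transpose (L t)) t = L1 t ** transpose (L1 t) + L2 t ** transpose (L t)"
      using t by (intro D_eq matrix_mult.has_vector_derivative dL1 has_vector_derivative_transpose dL)
    moreover have "D t0 (\<lambda>t. L1 t ** transpose (L t)) t = D t0 N t"
      using N_eq t by (rule D_cong)
    moreover have "D t0 N t = N1 t"
      using dN[OF t] t by (rule D_eq)
    ultimately show ?thesis by (simp add: add.commute)
  qed
  \<comment> \<open>Right multiplication by \<open>J\<close> undoes the factor \<open>L^T\<close>,
    giving \<open>L' = N J\<close> and \<open>L'' = (N' - L' L'^T) J\<close>. Continuity of
    \<open>L''\<close> and the bounds on \<open>L'\<close> and \<open>L''\<close> are read off from
    these formulas.\<close>
  define J where "J t = matrix_inv (transpose (L t))" for t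
  have L1_J: "L1 t = N t ** J t" if "t0 \<le> t" for t
    by (simp add: J_def matrix_inv_cancel[OF invLT[OF that]] flip: N_eq[OF that])
  have L2_J: "L2 t = (N1 t - L1 t ** transpose (L1 t)) ** J t" if "t0 \<le> t" for t
    by (simp add: J_def matrix_inv_cancel[OF invLT[OF that]] flip: N1_eq[OF that])
  have contL: "continuous_on {t0..} L" "continuous_on {t0..} L1"
    using dL dL1 by (auto intro!: continuous_on_vector_derivative)
  \<comment> \<open>\<open>K\<close> is only assumed differentiable; continuity of its derivative
    comes from solving the differential equation for it.\<close>
  have "continuous_on {t0..} (\<lambda>t. - (1/2) *\<^sub>R (A t ** K t + K t ** transpose (A t)
          + A t ** S t - S t ** transpose (A t) + B t ** P t - P t ** transpose (B t)))"
    by (intro continuous_intros matrix_mult.continuous_on continuous_on_transpose contAB contSK contP)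
  moreover have "- (1/2) *\<^sub>R (A t ** K t + K t ** transpose (A t)
      + A t ** S t - S t ** transpose (A t) + B t ** P t - P t ** transpose (B t)) = D t0 K t"
    if "t0 \<le> t" for t
  proof -
    have "(A t ** K t + K t ** transpose (A t)
      + A t ** S t - S t ** transpose (A t) + B t ** P t - P t ** transpose (B t)) = - (2 *\<^sub>R D t0 K t)"
      using eqn[OF that] by (simp add: P_def eq_neg_iff_add_eq_0 algebra_simps)
    then show ?thesis by simp
  qed
  ultimately have contDK: "continuous_on {t0..} (D t0 K)"
    by (rule continuous_on_eq) simp
  have contJ: "continuous_on {t0..} J"
    unfolding J_def[abs_def] using invLT by (intro continuous_on_matrix_inv continuous_on_transpose contL) auto
  have "continuous_on {t0..} (\<lambda>t. (N1 t - L1 t ** transpose (L1 t)) ** J t)"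
    unfolding N1_def[abs_def]
    by (intro continuous_intros matrix_mult.continuous_on continuous_on_transpose contL contDS contDK contJ)
  then have contL2: "continuous_on {t0..} L2"
    by (rule continuous_on_eq) (simp add: L2_J)
  have L_C2: "L \<in> mat_C 2 t0"
    unfolding numeral_2_eq_2 using dL dL1 contL2 by (intro mat_C_SucI) (auto simp: mat_C_0_iff)
  have contI: "continuous_on {t0..} (\<lambda>t. matrix_inv (L t))"
    using invL by (intro continuous_on_matrix_inv contL) auto
  \<comment> \<open>The trace of \<open>Lambda\<close> is the squared Frobenius norm of
    \<open>L\<close>. The bound is \<open>\<bar>\<mu>\<bar>\<close> because no sign of
    \<open>\<mu>\<close> is assumed here.\<close>
  have bL: "bounded (L ` {t0..})"
    unfolding bounded_iff
  proof (intro exI[of _ "\<bar>\<mu>\<bar>"] ballI, elim imageE)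
    fix X t assume X: "X = L t" and "t \<in> {t0..}"
    then have t: "t0 \<le> t" by simp
    have "(norm (L t))\<^sup>2 = 2 * integral {t0..t} (\<lambda>\<nu>. trace (S \<nu>)) + trace S0"
      using bounded_linear_Lambda[OF bounded_linear_trace contSK(1), of S0 t]
      by (simp add: LL[OF t] P_def flip: trace_mult_transpose)
    also have "\<dots> \<le> \<mu>\<^sup>2"
      using trace[OF t] by linarith
    finally show "norm X \<le> \<bar>\<mu>\<bar>"
      unfolding X by (simp add: abs_le_square_iff[of "norm (L t)" \<mu>, symmetric])
  qed
  have bJ: "bounded (J ` {t0..})"
    unfolding J_def[abs_def] using detL \<open>\<eta> > 0\<close>
    by (intro bounded_matrix_inv[of _ _ \<eta>] bounded_transpose bL) auto
  have bL1: "bounded (L1 ` {t0..})" if "k \<ge> 1"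
  proof -
    have "bounded ((\<lambda>t. N t ** J t) ` {t0..})"
      unfolding N_def[abs_def] using bdd[of 0] that
      by (intro bounded_matrix_mult bounded_plus_comp bJ) (auto simp: bdd_above_norm_image_iff)
    then show ?thesis
      using L1_J by (simp cong: image_cong_simp)
  qed
  \<comment> \<open>For \<open>k = 2\<close> the derivatives of \<open>S\<close> and
    \<open>K\<close> are bounded too, hence \<open>N1\<close>; the quadratic term is controlled by
    the bound on \<open>L1\<close>.\<close>
  have bL2: "bounded (L2 ` {t0..})" if "k \<ge> 2"
  proof -
    have "bounded ((\<lambda>t. (N1 t - L1 t ** transpose (L1 t)) ** J t) ` {t0..})"
      unfolding N1_def[abs_def] using bdd[of 1] that bL1
      by (intro bounded_matrix_mult bounded_plus_comp bounded_minus_comp bounded_transpose bJ)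
        (auto simp: bdd_above_norm_image_iff)
    then show ?thesis
      using L2_J by (simp cong: image_cong_simp)
  qed
  have "bdd_above ((\<lambda>t. norm ((D t0 ^^ i) L t)) ` {t0..})" if i: "i \<le> k" for i
  proof -
    consider "i = 0" | "i = 1" | "i = 2" using i k by linarith
    then show ?thesis
      using bL bL1 bL2 i
      by cases (auto simp: bdd_above_norm_image_iff L1_def L2_def numeral_2_eq_2)
  qed
  \<comment> \<open>\<open>L_matrix\<close> asks for a strict inequality whereas \<open>detL\<close>
    is not strict, so the constant is halved.\<close>
  moreover have "\<exists>\<eta>>0. \<forall>t\<ge>t0. \<bar>det (L t)\<bar> > \<eta>"
  proof (intro exI[of _ "\<eta> / 2"] conjI allI impI)
    show "\<bar>det (L t)\<bar> > \<eta> / 2" if "t0 \<le> t" for t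
      using detL[OF that] \<open>\<eta> > 0\<close> by linarith
  qed (use \<open>\<eta> > 0\<close> in simp)
  ultimately have Lm: "L_matrix k t0 L"
    using L_C2 by (simp add: L_matrix_def)
  define V where "V t = matrix_inv (L t) ** (2 *\<^sub>R L1 t + A t ** L t)" for t
  define W where "W t = matrix_inv (L t) ** (L2 t + A t ** L1 t + B t ** L t)" for t
  have "V \<in> mat_C 0 t0" "W \<in> mat_C 0 t0"
    unfolding mat_C_0_iff V_def[abs_def] W_def[abs_def]
    by (intro continuous_intros matrix_mult.continuous_on contI contL contL2 contAB)+
  then have "L_equivalent k t0 A B V W"
    unfolding L_equivalent_def using A B Lm
    by (auto simp: V_def W_def L1_def L2_def numeral_2_eq_2 intro!: exI[of _ L])
  moreover have "symmetric_matrix (W t)" if t: "t0 \<le> t" for t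
    unfolding W_def
    using symmetric_coefficient_iff[OF invL[OF t] N_eq[OF t, unfolded N_def]
        N1_eq[OF t, unfolded N1_def] symS[OF t] symDS[OF t] symK[OF t] symDK[OF t], of "A t" "B t"]
      eqn[OF t] by (simp add: LL[OF t] P_def)
  ultimately show ?thesis by blast
qed

theorem theorem3:
  fixes t0 :: real and k :: nat and A B :: "real \<Rightarrow> real ^ 'm ^ 'm"
  assumes "k \<in> {0, 1, 2}"
    and "A \<in> mat_C 0 t0" and "B \<in> mat_C 0 t0"
  shows "(\<exists>V W. L_equivalent k t0 A B V W \<and> (\<forall>t\<ge>t0. symmetric_matrix (W t))) \<longleftrightarrow>
    (\<exists>S S0 K.
       S \<in> mat_C 1 t0 \<and> (\<forall>t\<ge>t0. symmetric_matrix (S t)) \<and>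
       symmetric_matrix S0 \<and> positive_definite S0 \<and>
       K differentiable_on {t0..} \<and> (\<forall>t\<ge>t0. skew_symmetric_matrix (K t)) \<and>
       (\<forall>t\<ge>t0.
          2 *\<^sub>R D t0 K t + A t ** K t + K t ** transpose (A t)
          + A t ** S t - S t ** transpose (A t)
          + B t ** Lambda t0 S S0 t - Lambda t0 S S0 t ** transpose (B t) = 0) \<and>
       (\<exists>\<mu>>0. \<exists>\<eta>>0. \<forall>t\<ge>t0.
          \<bar>2 * integral {t0..t} (\<lambda>\<nu>. trace (S \<nu>)) + trace S0\<bar> \<le> \<mu>\<^sup>2 \<and>
          det (2 *\<^sub>R integral {t0..t} S + S0) \<ge> \<eta>\<^sup>2) \<and>
       (k \<noteq> 0 \<longrightarrow> (\<forall>i\<in>{0..k - 1}.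
          bdd_above ((\<lambda>t. norm ((D t0 ^^ i) K t)) ` {t0..}) \<and>
          bdd_above ((\<lambda>t. norm ((D t0 ^^ i) S t)) ` {t0..}))))"
    (is "?L \<longleftrightarrow> ?R")
proof
  assume ?L
  then obtain V W where "L_equivalent k t0 A B V W" "\<And>t. t0 \<le> t \<Longrightarrow> symmetric_matrix (W t)"
    by blast
  moreover have "k \<le> 2" using assms(1) by auto
  ultimately show ?R by (intro equation_if_L_equivalent)
next
  assume ?R
  then obtain S S0 K \<mu> \<eta> where S: "S \<in> mat_C 1 t0" "\<forall>t\<ge>t0. symmetric_matrix (S t)"
    and S0: "symmetric_matrix S0" "positive_definite S0"
    and K: "K differentiable_on {t0..}" "\<forall>t\<ge>t0. skew_symmetric_matrix (K t)"
    and eqn: "\<forall>t\<ge>t0.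
          2 *\<^sub>R D t0 K t + A t ** K t + K t ** transpose (A t)
          + A t ** S t - S t ** transpose (A t)
          + B t ** Lambda t0 S S0 t - Lambda t0 S S0 t ** transpose (B t) = 0"
    and "0 < \<eta>" and bounds: "\<forall>t\<ge>t0.
          \<bar>2 * integral {t0..t} (\<lambda>\<nu>. trace (S \<nu>)) + trace S0\<bar> \<le> \<mu>\<^sup>2 \<and>
          det (2 *\<^sub>R integral {t0..t} S + S0) \<ge> \<eta>\<^sup>2"
    and bdd: "k \<noteq> 0 \<longrightarrow> (\<forall>i\<in>{0..k - 1}.
          bdd_above ((\<lambda>t. norm ((D t0 ^^ i) K t)) ` {t0..}) \<and>
          bdd_above ((\<lambda>t. norm ((D t0 ^^ i) S t)) ` {t0..}))"
    by (elim exE conjE) (rule that; assumption)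
  have k: "k \<le> 2" using assms(1) by auto
  show ?L
  proof (rule L_equivalent_if_equation[OF k assms(2,3) S(1) S(2)[rule_format] S0
        K(1) K(2)[rule_format] eqn[rule_format] _ \<open>0 < \<eta>\<close>])
    show "\<bar>2 * integral {t0..t} (\<lambda>\<nu>. trace (S \<nu>)) + trace S0\<bar> \<le> \<mu>\<^sup>2"
      "det (2 *\<^sub>R integral {t0..t} S + S0) \<ge> \<eta>\<^sup>2" if "t0 \<le> t" for t
      using bounds that by simp_all
    \<comment> \<open>Subtraction on naturals is truncated, but \<open>i < k\<close> forces
      \<open>k \<noteq> 0\<close>, and then \<open>{0..k - 1}\<close> consists of exactly the
      indices below \<open>k\<close>.\<close>
    show "bdd_above ((\<lambda>t. norm ((D t0 ^^ i) K t)) ` {t0..}) \<and>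
        bdd_above ((\<lambda>t. norm ((D t0 ^^ i) S t)) ` {t0..})" if "i < k" for i
      using bdd that by auto
  qed
qed

end
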